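(* Let $\mathcal{H}$ be a complex Hilbert space and let $T\in\mathcal{B}(\mathcal{H})$ have closed range. Then the following are equivalent: (1) $T$ is EP. (2) There exist Hilbert spaces $\mathcal{K}_1$ and $\mathcal{L}_1$, an isomorphism $U_1\in\mathcal{B}(\mathcal{K}_1\oplus\mathcal{L}_1,\mathcal{H})$, an isomorphism $A_1\in\mathcal{B}(\mathcal{K}_1)$ and $B_1\in\mathcal{B}(\mathcal{K}_1)$ such that $T=U_1(A_1\oplus 0)U_1^{-1}$ and $T^*=U_1(B_1\oplus 0)U_1^{-1}$.
   Context: All Hilbert spaces are complex. $\mathcal{B}(\mathcal{H},\mathcal{K})$ denotes the bounded linear operators from $\mathcal{H}$ to $\mathcal{K}$, and $\mathcal{B}(\mathcal{H})=\mathcal{B}(\mathcal{H},\mathcal{H})$. $\mathcal{N}(T)$ is the kernel of $T$ and $T^*$ its adjoint. An operator $T\in\mathcal{B}(\mathcal{H})$ with closed range is called EP if $\mathcal{N}(T)=\mathcal{N}(T^* )$. A bounded operator is an isomorphism if it is injective and onto (not necessarily isometric). $\mathcal{K}\oplus\mathcal{L}$ is the exterior Hilbert space ($2$-)direct sum, and for $A\in\mathcal{B}(\mathcal{K})$ and $S\in\mathcal{B}(\mathcal{L})$, $A\oplus S$ is the direct sum operator $(y,z)\mapsto(Ay,Sz)$ on $\mathcal{K}\oplus\mathcal{L}$; in $A\oplus 0$ the $0$ is the zero operator on the second summand. *)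

theory Defs
  imports "HOL-Analysis.Abstract_Metric_Spaces" "HOL-Algebra.Module" "HOL-Algebra.AbelCoset"
begin

text \<open>
  Hilbert spaces are set-based structures, because the theorem quantifies existentially over
  Hilbert spaces. The vector space part is a HOL-Algebra module over the field of complex numbers;
  the ring fields \<open>mult\<close> and \<open>one\<close> that this record type also carries have no meaning here.
\<close>

definition complex_ring :: "complex ring" where
  "complex_ring = \<lparr>carrier = UNIV, mult = (*), one = 1, zero = 0, add = (+)\<rparr>"

lemma complex_ring_simps [simp]:
  "carrier complex_ring = UNIV" "a \<otimes>\<^bsub>complex_ring\<^esub> b = a * b" "\<one>\<^bsub>complex_ring\<^esub> = 1"
  "\<zero>\<^bsub>complex_ring\<^esub> = 0" "a \<oplus>\<^bsub>complex_ring\<^esub> b = a + b"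
  by (simp_all add: complex_ring_def)

lemma cring_complex_ring: "cring complex_ring"
  by (rule cringI; (rule abelian_groupI comm_monoidI)?)
     (auto simp: algebra_simps intro: exI[of _ "- x" for x] add.right_inverse)

lemma complex_ring_minus [simp]: "\<ominus>\<^bsub>complex_ring\<^esub> a = - a"
proof -
  interpret cring complex_ring by (rule cring_complex_ring)
  have "\<ominus>\<^bsub>complex_ring\<^esub> a + a = 0" using l_neg[of a] by simp
  then show ?thesis by (simp add: eq_neg_iff_add_eq_0)
qed

record 'a cinner_space = "(complex, 'a) module" +
  cinner :: "'a \<Rightarrow> 'a \<Rightarrow> complex"

definition cnorm :: "'a cinner_space \<Rightarrow> 'a \<Rightarrow> real" where
  "cnorm H x = sqrt (Re (cinner H x x))"

text \<open>
  The locale \<^locale>\<open>Metric_space\<close> wants the metric to be symmetric and nonnegative on the whole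
  type, hence the value 0 outside the carrier.
\<close>

definition cdist :: "'a cinner_space \<Rightarrow> 'a \<Rightarrow> 'a \<Rightarrow> real" where
  "cdist H x y = (if x \<in> carrier H \<and> y \<in> carrier H then cnorm H (x \<ominus>\<^bsub>H\<^esub> y) else 0)"

text \<open>The inner product is linear in its first argument.\<close>

locale complex_inner_product_space = Module.module complex_ring H
  for H :: "'a cinner_space" (structure) +
  assumes cinner_add_left:
      "\<lbrakk>x \<in> carrier H; y \<in> carrier H; z \<in> carrier H\<rbrakk>
        \<Longrightarrow> cinner H (x \<oplus> y) z = cinner H x z + cinner H y z"
    and cinner_smult_left:
      "\<lbrakk>x \<in> carrier H; y \<in> carrier H\<rbrakk> \<Longrightarrow> cinner H (c \<odot> x) y = c * cinner H x y"
    and cinner_commute: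
      "\<lbrakk>x \<in> carrier H; y \<in> carrier H\<rbrakk> \<Longrightarrow> cinner H x y = cnj (cinner H y x)"
    and cinner_pos:
      "\<lbrakk>x \<in> carrier H; x \<noteq> \<zero>\<rbrakk> \<Longrightarrow> 0 < Re (cinner H x x)"

context complex_inner_product_space begin

lemma minus_eq_smult: "x \<in> carrier H \<Longrightarrow> \<ominus> x = (-1) \<odot> x"
  using smult_l_minus[of 1 x] smult_one[of x] by simp

lemma cinner_add_right:
  "\<lbrakk>x \<in> carrier H; y \<in> carrier H; z \<in> carrier H\<rbrakk> \<Longrightarrow> cinner H z (x \<oplus> y) = cinner H z x + cinner H z y"
  by (metis cinner_add_left cinner_commute complex_cnj_add M.a_closed)

lemma cinner_smult_right:
  "\<lbrakk>x \<in> carrier H; y \<in> carrier H\<rbrakk> \<Longrightarrow> cinner H y (c \<odot> x) = cnj c * cinner H y x"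
  by (metis cinner_smult_left cinner_commute complex_cnj_mult smult_closed UNIV_I complex_ring_simps(1))

lemma cinner_zero: "x \<in> carrier H \<Longrightarrow> cinner H \<zero> x = 0"
  using cinner_smult_left[of "x" "x" 0] smult_l_null[of x] by simp

lemma cinner_nonneg: "x \<in> carrier H \<Longrightarrow> 0 \<le> Re (cinner H x x)"
  by (metis cinner_pos cinner_zero less_eq_real_def zero_complex.sel(1))

lemma cinner_self: "x \<in> carrier H \<Longrightarrow> cinner H x x = complex_of_real (Re (cinner H x x))"
  by (metis cinner_commute complex_is_Real_iff Reals_cnj_iff of_real_Re)

lemma cauchy_schwarz:
  assumes "x \<in> carrier H" "y \<in> carrier H"
  shows "cmod (cinner H x y) \<le> cnorm H x * cnorm H y"
proof (cases "y = \<zero>")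
  case True
  then show ?thesis using assms cinner_zero cinner_commute[of x y] by (simp add: cnorm_def)
next
  case False
  define p where "p = Re (cinner H y y)"
  define a where "a = cinner H x y"
  have p: "p > 0" "cinner H y y = p" using False assms cinner_pos cinner_self p_def by auto
  have a': "cinner H y x = cnj a" using assms a_def cinner_commute by blast
  let ?v = "x \<oplus> (- (a / p)) \<odot> y"
  have "0 \<le> Re (cinner H ?v ?v)" using assms by (intro cinner_nonneg) auto
  also have "cinner H ?v ?v = cinner H x x - cnj (a/p) * a - (a/p) * cnj a + (a/p) * cnj (a/p) * p"
    using assms p a' by (simp add: cinner_add_left cinner_add_right cinner_smult_left cinner_smult_right a_def[symmetric] algebra_simps)
  also have "\<dots> = cinner H x x - a * cnj a / p"
    using p by (simp add: field_simps)
  also have "a * cnj a / p = complex_of_real ((cmod a)^2 / p)" by (simp only: complex_norm_square[symmetric]) simp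
  finally have "(cmod a)^2 \<le> Re (cinner H x x) * p" using p by (simp add: field_simps)
  then have "sqrt ((cmod a)^2) \<le> sqrt (Re (cinner H x x) * p)" by (rule real_sqrt_le_mono)
  then show ?thesis by (simp add: cnorm_def a_def p_def real_sqrt_mult)
qed

lemma cnorm_triangle:
  assumes "x \<in> carrier H" "y \<in> carrier H"
  shows "cnorm H (x \<oplus> y) \<le> cnorm H x + cnorm H y"
proof -
  have n: "(cnorm H z)^2 = Re (cinner H z z)" "0 \<le> cnorm H z" if "z \<in> carrier H" for z
    using cinner_nonneg[OF that] by (auto simp: cnorm_def)
  have r: "Re (cinner H x y) \<le> cnorm H x * cnorm H y"
    using cauchy_schwarz[OF assms] complex_Re_le_cmod order_trans by blast
  have "Re (cinner H y x) = Re (cinner H x y)" using cinner_commute[OF assms] by simp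
  then have "(cnorm H (x \<oplus> y))^2 \<le> (cnorm H x + cnorm H y)^2"
    using r n assms by (simp add: cinner_add_left cinner_add_right power2_sum)
  then show ?thesis using n assms by (meson power2_le_imp_le add_nonneg_nonneg)
qed

sublocale Metric_space "carrier H" "cdist H"
proof
  fix x y show "0 \<le> cdist H x y"
    by (cases "x \<in> carrier H \<and> y \<in> carrier H") (simp_all add: cdist_def cnorm_def cinner_nonneg)
next
  fix x y
  have "cnorm H (x \<ominus> y) = cnorm H (y \<ominus> x)" if "x \<in> carrier H" "y \<in> carrier H"
  proof -
    have "x \<ominus> y = (-1) \<odot> (y \<ominus> x)" using that
      by (metis M.minus_closed M.minus_minus minus_eq_smult a_minus_def M.a_comm M.a_inv_closed M.minus_add)
    then show ?thesis using that by (simp add: cnorm_def cinner_smult_left cinner_smult_right)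
  qed
  then show "cdist H x y = cdist H y x" by (auto simp: cdist_def)
next
  fix x y assume "x \<in> carrier H" "y \<in> carrier H"
  moreover from this have "cnorm H (x \<ominus> y) = 0 \<longleftrightarrow> x \<ominus> y = \<zero>"
    by (metis M.minus_closed M.zero_closed cinner_pos cinner_zero cnorm_def less_irrefl real_sqrt_eq_zero_cancel_iff zero_complex.sel(1))
  ultimately show "cdist H x y = 0 \<longleftrightarrow> x = y" by (metis cdist_def a_minus_def M.r_neg M.minus_equality M.minus_minus M.a_inv_closed)
next
  fix x y z assume "x \<in> carrier H" "y \<in> carrier H" "z \<in> carrier H"
  moreover from this have "x \<ominus> z = (x \<ominus> y) \<oplus> (y \<ominus> z)"
    by (simp add: a_minus_def M.a_assoc M.r_neg1 M.l_neg)
  ultimately show "cdist H x z \<le> cdist H x y + cdist H y z"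
    using cnorm_triangle[of "x \<ominus> y" "y \<ominus> z"] by (simp add: cdist_def)
qed

end

locale complex_hilbert_space = complex_inner_product_space +
  assumes complete: "Metric_space.mcomplete (carrier H) (cdist H)"

definition ctopology :: "'a cinner_space \<Rightarrow> 'a topology" where
  "ctopology H = Metric_space.mtopology (carrier H) (cdist H)"

text \<open>
  Operators are functions on the type; only their values on the carrier of the domain matter.
\<close>

definition bounded_operators :: "'a cinner_space \<Rightarrow> 'b cinner_space \<Rightarrow> ('a \<Rightarrow> 'b) set" where
  "bounded_operators H K = {T. T \<in> carrier H \<rightarrow> carrier K
     \<and> (\<forall>x\<in>carrier H. \<forall>y\<in>carrier H. T (x \<oplus>\<^bsub>H\<^esub> y) = T x \<oplus>\<^bsub>K\<^esub> T y)
     \<and> (\<forall>c. \<forall>x\<in>carrier H. T (c \<odot>\<^bsub>H\<^esub> x) = c \<odot>\<^bsub>K\<^esub> T x)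
     \<and> (\<exists>C. \<forall>x\<in>carrier H. cnorm K (T x) \<le> C * cnorm H x)}"

definition isomorphisms :: "'a cinner_space \<Rightarrow> 'b cinner_space \<Rightarrow> ('a \<Rightarrow> 'b) set" where
  "isomorphisms H K = {T \<in> bounded_operators H K. bij_betw T (carrier H) (carrier K)}"

definition cadjoint :: "'a cinner_space \<Rightarrow> 'b cinner_space \<Rightarrow> ('a \<Rightarrow> 'b) \<Rightarrow> 'b \<Rightarrow> 'a" where
  "cadjoint H K T y =
     (THE z. z \<in> carrier H \<and> (\<forall>x\<in>carrier H. cinner K (T x) y = cinner H x z))"

definition closed_range :: "'a cinner_space \<Rightarrow> 'b cinner_space \<Rightarrow> ('a \<Rightarrow> 'b) \<Rightarrow> bool" where
  "closed_range H K T \<longleftrightarrow> closedin (ctopology K) (T ` carrier H)"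

definition EP_operator :: "'a cinner_space \<Rightarrow> ('a \<Rightarrow> 'a) \<Rightarrow> bool" where
  "EP_operator H T \<longleftrightarrow> T \<in> bounded_operators H H \<and> closed_range H H T
     \<and> a_kernel H H T = a_kernel H H (cadjoint H H T)"

definition hilbert_sum ::
    "'a cinner_space \<Rightarrow> 'b cinner_space \<Rightarrow> ('a \<times> 'b) cinner_space" (infixr \<open>\<oplus>\<^sub>H\<close> 65) where
  "K \<oplus>\<^sub>H L = \<lparr>carrier = carrier K \<times> carrier L,
     mult = undefined, one = undefined,
     zero = (\<zero>\<^bsub>K\<^esub>, \<zero>\<^bsub>L\<^esub>),
     add = (\<lambda>(y, z) (y', z'). (y \<oplus>\<^bsub>K\<^esub> y', z \<oplus>\<^bsub>L\<^esub> z')),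
     smult = (\<lambda>c (y, z). (c \<odot>\<^bsub>K\<^esub> y, c \<odot>\<^bsub>L\<^esub> z)),
     cinner = (\<lambda>(y, z) (y', z'). cinner K y y' + cinner L z z')\<rparr>"

text \<open>
  The operator \<open>A \<oplus> S\<close> on \<open>K \<oplus>\<^sub>H L\<close> is \<^term>\<open>map_prod A S\<close>, so \<open>A \<oplus> 0\<close> is
  \<^term>\<open>map_prod A (\<lambda>_. \<zero>\<^bsub>L\<^esub>)\<close>.
\<close>

definition simultaneous_sum_form ::
    "'h cinner_space \<Rightarrow> ('h \<Rightarrow> 'h) \<Rightarrow> 'k cinner_space \<Rightarrow> 'l cinner_space \<Rightarrow> bool" where
  "simultaneous_sum_form H T K L \<longleftrightarrow>
     (\<exists>U A B. U \<in> isomorphisms (K \<oplus>\<^sub>H L) H \<and> A \<in> isomorphisms K K \<and> B \<in> bounded_operators K K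
       \<and> (\<forall>x\<in>carrier H.
            T x = U (map_prod A (\<lambda>_. \<zero>\<^bsub>L\<^esub>) (inv_into (carrier (K \<oplus>\<^sub>H L)) U x)))
       \<and> (\<forall>x\<in>carrier H.
            cadjoint H H T x = U (map_prod B (\<lambda>_. \<zero>\<^bsub>L\<^esub>) (inv_into (carrier (K \<oplus>\<^sub>H L)) U x))))"

end

theory Submission
  imports Defs
begin

text \<open>
  The range \<open>R\<close> of \<open>T\<close> is closed, so \<open>H\<close> is the orthogonal sum of \<open>R\<close> and its orthogonal
  complement, which is the kernel of the adjoint. If \<open>T\<close> is EP, this complement is the kernel \<open>N\<close>
  of \<open>T\<close>. Then \<open>T\<close> restricts to a bijection of \<open>R\<close>, because \<open>T (y \<oplus> z) = T y\<close> for \<open>z\<close> in \<open>N\<close> and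
  \<open>R\<close> meets \<open>N\<close> only in zero; the adjoint vanishes on \<open>N\<close> and takes its values in the orthogonal
  complement of \<open>N\<close>, which is \<open>R\<close>. So \<open>K1 = R\<close>, \<open>L1 = N\<close> and \<open>U (y, z) = y \<oplus> z\<close> give the sum form.

  Conversely, a sum form identifies the range and the kernel of \<open>T\<close> with the two summands, and the
  kernel of \<open>T\<close> is contained in the kernel of the adjoint, that is, in the orthogonal complement of
  the range. Since range and kernel span \<open>H\<close>, the kernel fills this complement, and \<open>T\<close> is EP.

  The tools are the Riesz representation theorem, which provides the adjoint, and orthogonal
  decomposition along a closed subspace. Riesz is proved by minimizing a quadratic functional, which
  needs no closed subspaces; decomposition then follows by applying Riesz to the subspace, itself a
  Hilbert space.
\<close>

section \<open>Norm and distance in an inner product space\<close>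

context complex_inner_product_space begin

lemma cnorm_nonneg: "x \<in> carrier H \<Longrightarrow> 0 \<le> cnorm H x"
  by (simp add: cnorm_def cinner_nonneg)

lemma cnorm_squared: "x \<in> carrier H \<Longrightarrow> (cnorm H x)\<^sup>2 = Re (cinner H x x)"
  by (simp add: cnorm_def cinner_nonneg)

lemma minus_conv_smult:
  "\<lbrakk>x \<in> carrier H; y \<in> carrier H\<rbrakk> \<Longrightarrow> x \<ominus> y = x \<oplus> (-1) \<odot> y"
  by (simp add: a_minus_def minus_eq_smult)

lemma cinner_minus_left:
  "\<lbrakk>x \<in> carrier H; y \<in> carrier H; z \<in> carrier H\<rbrakk>
    \<Longrightarrow> cinner H (x \<ominus> y) z = cinner H x z - cinner H y z"
  by (simp add: minus_conv_smult cinner_add_left cinner_smult_left)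

lemma cinner_minus_right:
  "\<lbrakk>x \<in> carrier H; y \<in> carrier H; z \<in> carrier H\<rbrakk>
    \<Longrightarrow> cinner H z (x \<ominus> y) = cinner H z x - cinner H z y"
  by (simp add: minus_conv_smult cinner_add_right cinner_smult_right)

lemma cinner_zero_right: "x \<in> carrier H \<Longrightarrow> cinner H x \<zero> = 0"
  by (metis M.zero_closed cinner_commute cinner_zero complex_cnj_zero)

lemma cinner_self_eq_zero: "\<lbrakk>x \<in> carrier H; cinner H x x = 0\<rbrakk> \<Longrightarrow> x = \<zero>"
  using cinner_pos by force

lemma eq_if_minus_zero: "\<lbrakk>x \<in> carrier H; y \<in> carrier H; x \<ominus> y = \<zero>\<rbrakk> \<Longrightarrow> x = y"
  by (metis a_minus_def M.minus_equality M.minus_minus M.a_inv_closed)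

lemma cinner_right_eqI:
  assumes "x \<in> carrier H" "y \<in> carrier H"
    and "\<And>v. v \<in> carrier H \<Longrightarrow> cinner H v x = cinner H v y"
  shows "x = y"
proof (rule eq_if_minus_zero)
  show "x \<ominus> y = \<zero>"
    using assms by (intro cinner_self_eq_zero) (simp_all add: cinner_minus_right)
qed (use assms in auto)

lemma cdist_conv_cnorm:
  "\<lbrakk>x \<in> carrier H; y \<in> carrier H\<rbrakk> \<Longrightarrow> cdist H x y = cnorm H (x \<ominus> y)"
  by (simp add: cdist_def)

end

section \<open>The Riesz representation theorem\<close>

context complex_hilbert_space begin

text \<open>
  The representative of \<open>f\<close> minimizes \<open>q x = \<parallel>x\<parallel>\<^sup>2 - 2 Re (f x)\<close>. A minimizing sequence is Cauchy by
  the parallelogram identity, and the derivative of \<open>q\<close> vanishes at its limit.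
\<close>

theorem riesz_representation:
  assumes add: "\<And>x y. \<lbrakk>x \<in> carrier H; y \<in> carrier H\<rbrakk> \<Longrightarrow> f (x \<oplus> y) = f x + f y"
    and smult: "\<And>c x. x \<in> carrier H \<Longrightarrow> f (c \<odot> x) = c * f x"
    and bound: "\<And>x. x \<in> carrier H \<Longrightarrow> cmod (f x) \<le> C * cnorm H x"
  obtains z where "z \<in> carrier H" "\<And>x. x \<in> carrier H \<Longrightarrow> f x = cinner H x z"
proof -
  \<comment> \<open>if \<open>f\<close> is the inner product with \<open>z\<close>, then \<open>q x = \<parallel>x - z\<parallel>\<^sup>2 - \<parallel>z\<parallel>\<^sup>2\<close>\<close>
  define q where "q x = Re (cinner H x x) - 2 * Re (f x)" for x
  define i where "i = Inf (q ` carrier H)"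
  have lower: "- C\<^sup>2 \<le> q x" if x: "x \<in> carrier H" for x
  proof -
    have "Re (f x) \<le> C * cnorm H x"
      using bound[OF x] complex_Re_le_cmod[of "f x"] by linarith
    moreover have "0 \<le> (cnorm H x - C)\<^sup>2" by simp
    ultimately show ?thesis
      by (simp add: q_def cnorm_squared[OF x, symmetric] power2_eq_square algebra_simps)
  qed
  have bdd: "bdd_below (q ` carrier H)" using lower by (auto simp: bdd_below_def)
  have i_le: "i \<le> q x" if "x \<in> carrier H" for x
    unfolding i_def using that bdd by (intro cInf_lower) auto
  have ex: "\<exists>x\<in>carrier H. q x < i + e" if "e > 0" for e
  proof -
    have "Inf (q ` carrier H) < i + e" using that by (simp add: i_def)
    then show ?thesis
      using cInf_less_iff[of "q ` carrier H" "i + e"] bdd M.zero_closed by auto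
  qed
  have close: "(cnorm H (x \<ominus> y))\<^sup>2 \<le> 4 * e"
    if x: "x \<in> carrier H" and y: "y \<in> carrier H" and qx: "q x \<le> i + e" and qy: "q y \<le> i + e"
    for x y e
  proof -
    define m where "m = (1/2) \<odot> (x \<oplus> y)"
    have m: "m \<in> carrier H" using x y by (simp add: m_def)
    \<comment> \<open>the parallelogram identity; the linear terms cancel\<close>
    have "q x + q y - 2 * q m = (cnorm H (x \<ominus> y))\<^sup>2 / 2"
      using x y by (simp add: cnorm_squared q_def m_def add smult cinner_add_left cinner_add_right
          cinner_smult_left cinner_smult_right cinner_minus_left cinner_minus_right field_simps)
    then show ?thesis using qx qy i_le[OF m] by linarith
  qed
  \<comment> \<open>at a point where \<open>q\<close> is minimal up to \<open>e\<^sup>2\<close>, the derivative of \<open>q\<close> is small\<close>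
  have deriv: "\<bar>Re (cinner H v x) - Re (f v)\<bar> \<le> e * cnorm H v"
    if x: "x \<in> carrier H" and v: "v \<in> carrier H" and qx: "q x \<le> i + e\<^sup>2" and e: "0 < e" for x v e
  proof (cases "v = \<zero>")
    case True
    have "f \<zero> = 0" using smult[of \<zero> 0] by simp
    then show ?thesis using x e True by (simp add: cinner_zero cnorm_nonneg)
  next
    case False
    define b where "b = Re (cinner H v x) - Re (f v)"
    define V where "V = Re (cinner H v v)"
    have V: "V > 0" using False v cinner_pos V_def by blast
    have "Re (cinner H x v) = Re (cinner H v x)" using cinner_commute[OF x v] by simp
    then have "q (x \<oplus> complex_of_real t \<odot> v) = q x + t\<^sup>2 * V + 2 * t * b" for t
      using x v by (simp add: q_def b_def V_def add smult cinner_add_left cinner_add_right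
          cinner_smult_left cinner_smult_right power2_eq_square algebra_simps)
    \<comment> \<open>\<open>t = - b / V\<close> minimizes this quadratic polynomial in \<open>t\<close>\<close>
    from this[of "- b / V"] i_le[of "x \<oplus> complex_of_real (- b / V) \<odot> v"]
    have "i \<le> q x + (- b / V)\<^sup>2 * V + 2 * (- b / V) * b" using x v by simp
    also have "\<dots> = q x - b\<^sup>2 / V" using V by (simp add: field_simps power2_eq_square)
    finally have "b\<^sup>2 / V \<le> e\<^sup>2" using qx by linarith
    then have "b\<^sup>2 \<le> (e * cnorm H v)\<^sup>2"
      using V v by (simp add: power_mult_distrib cnorm_squared V_def[symmetric] field_simps)
    then show ?thesis
      using e v by (simp add: b_def[symmetric] cnorm_nonneg abs_le_square_iff[symmetric])
  qed
  define \<delta> where "\<delta> n = 1 / real (Suc n)" for n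
  have \<delta>: "\<delta> n > 0" for n by (simp add: \<delta>_def)
  have \<delta>_mono: "\<delta> n \<le> \<delta> N" if "N \<le> n" for n N using that by (simp add: \<delta>_def field_simps)
  have \<delta>_small: "\<exists>N. \<delta> N < e" if "e > 0" for e
    using that nat_approx_posE unfolding \<delta>_def by metis
  have "\<forall>n. \<exists>x. x \<in> carrier H \<and> q x < i + (\<delta> n)\<^sup>2"
    using ex \<delta> by (meson zero_less_power)
  then obtain s where s: "\<And>n. s n \<in> carrier H" "\<And>n. q (s n) < i + (\<delta> n)\<^sup>2" by metis
  have s_dist: "cdist H (s m) (s n) \<le> 2 * \<delta> N" if "N \<le> m" "N \<le> n" for m n N
  proof -
    have "(\<delta> k)\<^sup>2 \<le> (\<delta> N)\<^sup>2" if "N \<le> k" for k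
      using \<delta>_mono[OF that] \<delta>[of k] by (simp add: power_mono)
    then have "q (s m) \<le> i + (\<delta> N)\<^sup>2" "q (s n) \<le> i + (\<delta> N)\<^sup>2"
      using s(2)[of m] s(2)[of n] that by (smt (verit))+
    from close[OF s(1) s(1) this] have "(cnorm H (s m \<ominus> s n))\<^sup>2 \<le> (2 * \<delta> N)\<^sup>2"
      by (simp add: power_mult_distrib)
    then have "cnorm H (s m \<ominus> s n) \<le> 2 * \<delta> N"
      by (rule power2_le_imp_le) (simp add: less_imp_le[OF \<delta>])
    then show ?thesis using s(1) by (simp add: cdist_conv_cnorm)
  qed
  have "MCauchy s"
    unfolding MCauchy_def
  proof (intro conjI allI impI)
    show "range s \<subseteq> carrier H" using s(1) by auto
  next
    fix e :: real assume "e > 0"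
    then obtain N where "\<delta> N < e / 2" using \<delta>_small[of "e / 2"] by auto
    then show "\<exists>N. \<forall>m n. N \<le> m \<longrightarrow> N \<le> n \<longrightarrow> cdist H (s m) (s n) < e"
      using s_dist by (intro exI[of _ N]) (smt (verit) field_sum_of_halves)
  qed
  then obtain z where lim: "limitin mtopology s z sequentially"
    using complete mcomplete_def by blast
  then have z: "z \<in> carrier H" using limitin_mspace by blast
  have Re_eq: "Re (f v) = Re (cinner H v z)" if v: "v \<in> carrier H" for v
  proof -
    have small: "\<bar>Re (cinner H v z) - Re (f v)\<bar> \<le> e * (2 * cnorm H v)" if e: "0 < e" for e
    proof -
      obtain N1 where N1: "\<And>n. n \<ge> N1 \<Longrightarrow> cdist H (s n) z < e"
        using lim e unfolding limit_metric_sequentially by blast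
      obtain N2 where N2: "\<delta> N2 < e" using \<delta>_small[OF e] by blast
      define n where "n = max N1 N2"
      have "\<delta> n < e" using \<delta>_mono[of N2 n] N2 by (simp add: n_def)
      then have "(\<delta> n)\<^sup>2 \<le> e\<^sup>2" using \<delta>[of n] by (simp add: power_mono)
      then have "\<bar>Re (cinner H v (s n)) - Re (f v)\<bar> \<le> e * cnorm H v"
        using s(2)[of n] by (intro deriv s v e) simp
      moreover have "\<bar>Re (cinner H v (s n \<ominus> z))\<bar> \<le> cnorm H v * e"
      proof -
        have "\<bar>Re (cinner H v (s n \<ominus> z))\<bar> \<le> cnorm H v * cnorm H (s n \<ominus> z)"
          using cauchy_schwarz[OF v, of "s n \<ominus> z"] abs_Re_le_cmod order_trans s(1) z by blast
        also have "\<dots> \<le> cnorm H v * e"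
          using N1[of n] s(1) z v
          by (intro mult_left_mono) (simp_all add: cdist_conv_cnorm n_def cnorm_nonneg)
        finally show ?thesis .
      qed
      ultimately show ?thesis
        using s(1) z v by (simp add: cinner_minus_right algebra_simps)
    qed
    have "\<bar>Re (cinner H v z) - Re (f v)\<bar> \<le> 0"
    proof (rule field_le_epsilon)
      fix e :: real assume e: "e > 0"
      define d where "d = 2 * cnorm H v + 1"
      have d: "d > 0" using cnorm_nonneg[OF v] by (simp add: d_def)
      have "e / d * (2 * cnorm H v) \<le> e / d * d"
        using e d by (intro mult_left_mono) (simp_all add: d_def)
      then show "\<bar>Re (cinner H v z) - Re (f v)\<bar> \<le> 0 + e"
        using small[of "e / d"] e d by simp
    qed
    then show ?thesis by simp
  qed
  \<comment> \<open>the imaginary parts at \<open>v\<close> are, up to sign, the real parts at \<open>\<i> \<odot> v\<close>\<close>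
  have "f v = cinner H v z" if v: "v \<in> carrier H" for v
  proof (rule complex_eqI)
    show "Re (f v) = Re (cinner H v z)" by (rule Re_eq[OF v])
    show "Im (f v) = Im (cinner H v z)"
      using Re_eq[of "\<i> \<odot> v"] v z by (simp add: smult cinner_smult_left)
  qed
  with z show ?thesis by (rule that)
qed

end

section \<open>Bounded operators and their adjoints\<close>

lemma bounded_operatorsD:
  assumes "T \<in> bounded_operators H K"
  shows bounded_operators_closed: "x \<in> carrier H \<Longrightarrow> T x \<in> carrier K"
    and bounded_operators_add:
      "\<lbrakk>x \<in> carrier H; y \<in> carrier H\<rbrakk> \<Longrightarrow> T (x \<oplus>\<^bsub>H\<^esub> y) = T x \<oplus>\<^bsub>K\<^esub> T y"
    and bounded_operators_smult: "x \<in> carrier H \<Longrightarrow> T (c \<odot>\<^bsub>H\<^esub> x) = c \<odot>\<^bsub>K\<^esub> T x"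
  using assms by (auto simp: bounded_operators_def)

lemma bounded_operators_bound:
  assumes "complex_inner_product_space H" "T \<in> bounded_operators H K"
  obtains C where "0 < C" "\<And>x. x \<in> carrier H \<Longrightarrow> cnorm K (T x) \<le> C * cnorm H x"
proof -
  obtain C where "\<forall>x\<in>carrier H. cnorm K (T x) \<le> C * cnorm H x"
    using assms(2) unfolding bounded_operators_def by blast
  then have C: "\<And>x. x \<in> carrier H \<Longrightarrow> cnorm K (T x) \<le> C * cnorm H x" by blast
  have "C * cnorm H x \<le> max C 1 * cnorm H x" if "x \<in> carrier H" for x
    using complex_inner_product_space.cnorm_nonneg[OF assms(1) that]
    by (intro mult_right_mono) auto
  then show ?thesis using C by (intro that[of "max C 1"]) (auto intro: order_trans)
qed

text \<open>A bounded operator between inner product spaces that need not be complete.\<close>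

locale bounded_operator = dom: complex_inner_product_space H + cod: complex_inner_product_space K
  for H :: "'a cinner_space" and K :: "'b cinner_space" +
  fixes T :: "'a \<Rightarrow> 'b"
  assumes bounded: "T \<in> bounded_operators H K"
begin

lemmas closed [simp] = bounded_operators_closed[OF bounded]
lemmas add = bounded_operators_add[OF bounded]
lemmas smult = bounded_operators_smult[OF bounded]

lemma zero [simp]: "T \<zero>\<^bsub>H\<^esub> = \<zero>\<^bsub>K\<^esub>"
  using smult[of "\<zero>\<^bsub>H\<^esub>" 0] dom.smult_l_null[of "\<zero>\<^bsub>H\<^esub>"]
    cod.smult_l_null[of "T \<zero>\<^bsub>H\<^esub>"] by simp

lemma minus:
  "\<lbrakk>x \<in> carrier H; y \<in> carrier H\<rbrakk> \<Longrightarrow> T (x \<ominus>\<^bsub>H\<^esub> y) = T x \<ominus>\<^bsub>K\<^esub> T y"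
  by (simp add: dom.minus_conv_smult cod.minus_conv_smult add smult)

lemma kernel_submodule: "submodule (a_kernel H K T) complex_ring H"
  by (rule dom.submoduleI)
    (auto simp: a_kernel_def' add smult dom.minus_eq_smult)

lemma range_submodule: "submodule (T ` carrier H) complex_ring K"
proof (rule cod.submoduleI)
  show "T ` carrier H \<subseteq> carrier K" by auto
  show "\<zero>\<^bsub>K\<^esub> \<in> T ` carrier H" using zero by (metis dom.M.zero_closed imageI)
  show smult_in: "c \<odot>\<^bsub>K\<^esub> y \<in> T ` carrier H" if "y \<in> T ` carrier H" for c y
    using that by (auto simp: smult[symmetric])
  show "\<ominus>\<^bsub>K\<^esub> y \<in> T ` carrier H" if "y \<in> T ` carrier H" for y
    using that smult_in[OF that, of "-1"] by (auto simp: cod.minus_eq_smult)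
  show "y \<oplus>\<^bsub>K\<^esub> z \<in> T ` carrier H" if "y \<in> T ` carrier H" "z \<in> T ` carrier H" for y z
    using that by (auto simp: add[symmetric])
qed

lemma kernel_closed: "closedin (ctopology H) (a_kernel H K T)"
  unfolding ctopology_def dom.metric_closedin_iff_sequentially_closed
proof (intro conjI allI impI; (elim conjE)?)
  show "a_kernel H K T \<subseteq> carrier H" by (auto simp: a_kernel_def')
next
  fix s l assume s: "range s \<subseteq> a_kernel H K T" and lim: "limitin dom.mtopology s l sequentially"
  have l: "l \<in> carrier H" using lim dom.limitin_mspace by blast
  obtain C where C: "0 < C" "\<And>x. x \<in> carrier H \<Longrightarrow> cnorm K (T x) \<le> C * cnorm H x"
    using bounded_operators_bound[OF dom.complex_inner_product_space_axioms bounded] by blast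
  have "cnorm K (T l) \<le> 0"
  proof (rule field_le_epsilon)
    fix e :: real assume e: "0 < e"
    then have "0 < e / C" using C(1) by simp
    then obtain n where n: "s n \<in> carrier H" "cdist H (s n) l < e / C"
      using lim unfolding dom.limit_metric_sequentially by blast
    have "T (s n) = \<zero>\<^bsub>K\<^esub>" using s by (auto simp: a_kernel_def')
    then have "T (l \<ominus>\<^bsub>H\<^esub> s n) = T l"
      using l n(1) by (simp add: minus) (simp add: a_minus_def)
    then have "cnorm K (T l) \<le> C * cdist H l (s n)"
      using C(2)[of "l \<ominus>\<^bsub>H\<^esub> s n"] l n(1) by (simp add: dom.cdist_conv_cnorm)
    also have "\<dots> \<le> C * (e / C)"
      using C(1) n(2) by (intro mult_left_mono) (auto simp: dom.commute)
    finally show "cnorm K (T l) \<le> 0 + e" using C(1) by simp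
  qed
  then have "Re (cinner K (T l) (T l)) = 0"
    using l cod.cnorm_squared[of "T l"] cod.cnorm_nonneg[of "T l"] by simp
  then have "T l = \<zero>\<^bsub>K\<^esub>" using l cod.cinner_pos[of "T l"] by fastforce
  then show "l \<in> a_kernel H K T" using l by (simp add: a_kernel_def')
qed

end

text \<open>Completeness of the domain ensures, through Riesz, that the adjoint exists.\<close>

locale bounded_operator_on_hilbert_space = bounded_operator H K T + complex_hilbert_space H
  for H :: "'a cinner_space" and K :: "'b cinner_space" and T
begin

abbreviation Tstar :: "'b \<Rightarrow> 'a" where "Tstar \<equiv> cadjoint H K T"

lemma cadjoint:
  assumes y: "y \<in> carrier K"
  shows cadjoint_closed: "Tstar y \<in> carrier H"
    and cinner_cadjoint: "x \<in> carrier H \<Longrightarrow> cinner H x (Tstar y) = cinner K (T x) y"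
proof -
  obtain C where C: "0 < C" "\<And>x. x \<in> carrier H \<Longrightarrow> cnorm K (T x) \<le> C * cnorm H x"
    using bounded_operators_bound[OF dom.complex_inner_product_space_axioms bounded] by blast
  have "cmod (cinner K (T x) y) \<le> (C * cnorm K y) * cnorm H x" if x: "x \<in> carrier H" for x
  proof -
    have "cmod (cinner K (T x) y) \<le> cnorm K (T x) * cnorm K y"
      using x y by (simp add: cod.cauchy_schwarz)
    also have "\<dots> \<le> (C * cnorm H x) * cnorm K y"
      using C(2)[OF x] y by (intro mult_right_mono) (simp_all add: cod.cnorm_nonneg)
    finally show ?thesis by (simp add: algebra_simps)
  qed
  note bound = this
  obtain z where z: "z \<in> carrier H"
    "\<And>x. x \<in> carrier H \<Longrightarrow> cinner K (T x) y = cinner H x z"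
    by (rule riesz_representation[of "\<lambda>x. cinner K (T x) y" "C * cnorm K y"])
      (auto simp: add smult cod.cinner_add_left cod.cinner_smult_left y bound)
  have "\<exists>!z. z \<in> carrier H \<and> (\<forall>x\<in>carrier H. cinner K (T x) y = cinner H x z)"
    using z by (intro ex1I[of _ z]) (auto intro: dom.cinner_right_eqI)
  from theI'[OF this]
  have *: "Tstar y \<in> carrier H \<and> (\<forall>x\<in>carrier H. cinner K (T x) y = cinner H x (Tstar y))"
    unfolding cadjoint_def .
  show "Tstar y \<in> carrier H" using * ..
  show "cinner H x (Tstar y) = cinner K (T x) y" if "x \<in> carrier H"
    by (rule sym, rule bspec[OF conjunct2[OF *] that])
qed

lemma cadjoint_bounded: "Tstar \<in> bounded_operators K H"
proof -
  obtain C where C: "0 < C" "\<And>x. x \<in> carrier H \<Longrightarrow> cnorm K (T x) \<le> C * cnorm H x"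
    using bounded_operators_bound[OF dom.complex_inner_product_space_axioms bounded] by blast
  have "cnorm H (Tstar y) \<le> C * cnorm K y" if y: "y \<in> carrier K" for y
  proof (cases "cnorm H (Tstar y) = 0")
    case True
    then show ?thesis using C(1) y by (simp add: cod.cnorm_nonneg)
  next
    case False
    let ?z = "Tstar y"
    have z: "?z \<in> carrier H" by (rule cadjoint_closed[OF y])
    have "(cnorm H ?z)\<^sup>2 = Re (cinner K (T ?z) y)"
      using y z by (simp add: dom.cnorm_squared cinner_cadjoint)
    also have "\<dots> \<le> cnorm K (T ?z) * cnorm K y"
      using y z cod.cauchy_schwarz[of "T ?z" y] complex_Re_le_cmod order_trans by (meson closed)
    also have "\<dots> \<le> (C * cnorm H ?z) * cnorm K y"
      using C(2)[OF z] y by (intro mult_right_mono) (simp_all add: cod.cnorm_nonneg)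
    finally have "cnorm H ?z * cnorm H ?z \<le> cnorm H ?z * (C * cnorm K y)"
      by (simp add: power2_eq_square algebra_simps)
    then show ?thesis using False dom.cnorm_nonneg[OF z] by simp
  qed
  moreover have "Tstar (x \<oplus>\<^bsub>K\<^esub> y) = Tstar x \<oplus>\<^bsub>H\<^esub> Tstar y"
    if "x \<in> carrier K" "y \<in> carrier K" for x y
    using that by (intro dom.cinner_right_eqI)
      (simp_all add: cadjoint_closed cinner_cadjoint dom.cinner_add_right cod.cinner_add_right)
  moreover have "Tstar (c \<odot>\<^bsub>K\<^esub> x) = c \<odot>\<^bsub>H\<^esub> Tstar x" if "x \<in> carrier K" for c x
    using that by (intro dom.cinner_right_eqI)
      (simp_all add: cadjoint_closed cinner_cadjoint dom.cinner_smult_right cod.cinner_smult_right)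
  ultimately show ?thesis
    unfolding bounded_operators_def using cadjoint_closed by auto
qed

text \<open>The kernel of the adjoint is the orthogonal complement of the range.\<close>

lemma cadjoint_kernel:
  "a_kernel K H Tstar = {y \<in> carrier K. \<forall>x\<in>carrier H. cinner K (T x) y = 0}"
proof -
  have "Tstar y = \<zero>\<^bsub>H\<^esub> \<longleftrightarrow> (\<forall>x\<in>carrier H. cinner K (T x) y = 0)" if y: "y \<in> carrier K" for y
  proof
    assume "Tstar y = \<zero>\<^bsub>H\<^esub>"
    then show "\<forall>x\<in>carrier H. cinner K (T x) y = 0"
      using cinner_cadjoint[OF y] by (simp add: dom.cinner_zero_right)
  next
    assume *: "\<forall>x\<in>carrier H. cinner K (T x) y = 0"
    then show "Tstar y = \<zero>\<^bsub>H\<^esub>"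
      using y cinner_cadjoint[OF y] cadjoint_closed[OF y] by (intro dom.cinner_self_eq_zero) auto
  qed
  then show ?thesis by (auto simp: a_kernel_def')
qed

end

section \<open>Closed subspaces and orthogonal projection\<close>

context complex_hilbert_space begin

lemma closed_submodule_hilbert_space:
  assumes sub: "submodule S complex_ring H" and clo: "closedin (ctopology H) S"
  shows "complex_hilbert_space (H\<lparr>carrier := S\<rparr>)"
proof -
  let ?S = "H\<lparr>carrier := S\<rparr>"
  have subset: "S \<subseteq> carrier H" using submoduleE(1)[OF sub] .
  have in_S: "x \<in> carrier H" if "x \<in> S" for x using that subset by blast
  interpret S: complex_inner_product_space ?S
  proof (rule complex_inner_product_space.intro)
    show "Module.module complex_ring ?S"
      by (rule submodule.submodule_is_module[OF sub module_axioms])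
    show "complex_inner_product_space_axioms ?S"
      by unfold_locales
        (simp_all add: in_S cinner_add_left cinner_smult_left cinner_pos, metis in_S cinner_commute)
  qed
  \<comment> \<open>the differences agree although the additive inverse depends on the carrier\<close>
  have dist: "cdist ?S x y = cdist H x y" if "x \<in> S" "y \<in> S" for x y
    using that subset S.minus_conv_smult[of x y] minus_conv_smult[of x y]
    by (auto simp: cdist_def cnorm_def)
  have "S.mcomplete"
    unfolding S.mcomplete_def
  proof (intro allI impI)
    fix s assume s: "S.MCauchy s"
    then have s_in: "s n \<in> S" for n unfolding S.MCauchy_def by auto
    have "MCauchy s"
      using s s_in subset unfolding S.MCauchy_def MCauchy_def by (auto simp: dist)
    then obtain l where l: "limitin mtopology s l sequentially"
      using complete mcomplete_def by blast
    have "l \<in> S"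
      using clo l s_in unfolding ctopology_def metric_closedin_iff_sequentially_closed by blast
    then have "limitin S.mtopology s l sequentially"
      using l s_in \<open>l \<in> S\<close>
      unfolding S.limit_metric_sequentially limit_metric_sequentially by (simp add: dist in_S)
    then show "\<exists>l. limitin S.mtopology s l sequentially" ..
  qed
  then show ?thesis
    by (intro complex_hilbert_space.intro complex_hilbert_space_axioms.intro
        S.complex_inner_product_space_axioms) simp
qed

text \<open>
  The component of \<open>x\<close> in \<open>S\<close> is the Riesz representative, in the Hilbert space \<open>S\<close>, of the functional
  \<open>m \<mapsto> cinner H m x\<close>.
\<close>

theorem orthogonal_decomposition:
  assumes sub: "submodule S complex_ring H" and clo: "closedin (ctopology H) S"
    and x: "x \<in> carrier H"
  obtains y z where "y \<in> S" "z \<in> carrier H" "\<And>m. m \<in> S \<Longrightarrow> cinner H m z = 0" "x = y \<oplus> z"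
proof -
  have subset: "S \<subseteq> carrier H" using submoduleE(1)[OF sub] .
  interpret S: complex_hilbert_space "H\<lparr>carrier := S\<rparr>"
    by (rule closed_submodule_hilbert_space[OF sub clo])
  have in_S: "m \<in> carrier H" if "m \<in> S" for m using that subset by blast
  let ?f = "\<lambda>m. cinner H m x"
  obtain y where y: "y \<in> S" and y_inner: "\<And>m. m \<in> S \<Longrightarrow> ?f m = cinner H m y"
  proof (rule S.riesz_representation[of ?f "cnorm H x", simplified])
    show "?f (m \<oplus> n) = ?f m + ?f n" if "m \<in> S" "n \<in> S" for m n
      using in_S[OF that(1)] in_S[OF that(2)] x by (rule cinner_add_left)
    show "?f (c \<odot> m) = c * ?f m" if "m \<in> S" for c m
      using in_S[OF that] x by (rule cinner_smult_left)
    show "cmod (?f m) \<le> cnorm H x * cnorm (H\<lparr>carrier := S\<rparr>) m" if "m \<in> S" for m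
      using cauchy_schwarz[OF in_S[OF that] x] by (simp add: cnorm_def mult.commute)
  qed blast
  have z: "x \<ominus> y \<in> carrier H" using x in_S[OF y] by simp
  have orth: "cinner H m (x \<ominus> y) = 0" if "m \<in> S" for m
    using y_inner[of m] that x in_S[OF y] in_S[OF that] by (simp add: cinner_minus_right)
  have "x = y \<oplus> (x \<ominus> y)"
    using x in_S[OF y] by (simp add: a_minus_def M.a_lcomm M.r_neg)
  with y z orth show ?thesis by (rule that)
qed

end

section \<open>Orthogonal sums and EP operators\<close>

lemma hilbert_sum_simps [simp]:
  "carrier (K \<oplus>\<^sub>H L) = carrier K \<times> carrier L"
  "(y, z) \<oplus>\<^bsub>K \<oplus>\<^sub>H L\<^esub> (y', z') = (y \<oplus>\<^bsub>K\<^esub> y', z \<oplus>\<^bsub>L\<^esub> z')"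
  "c \<odot>\<^bsub>K \<oplus>\<^sub>H L\<^esub> (y, z) = (c \<odot>\<^bsub>K\<^esub> y, c \<odot>\<^bsub>L\<^esub> z)"
  "cinner (K \<oplus>\<^sub>H L) (y, z) (y', z') = cinner K y y' + cinner L z z'"
  by (simp_all add: hilbert_sum_def)

text \<open>
  In the sum form, the range of \<open>T\<close> is the image of \<open>K \<oplus> 0\<close> and its kernel the image of \<open>0 \<oplus> L\<close>;
  so range and kernel together span \<open>H\<close>, and the kernel of \<open>T\<close> lies in that of the adjoint, which
  is the orthogonal complement of the range. A vector of that complement is a sum \<open>T u \<oplus> n\<close> with
  \<open>n\<close> in the kernel, and \<open>T u\<close> is then orthogonal to itself.
\<close>

lemma simultaneous_sum_form_imp_EP_operator:
  assumes H: "complex_hilbert_space H"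
    and T: "T \<in> bounded_operators H H"
    and cl: "closed_range H H T"
    and K: "complex_inner_product_space K" and L: "complex_inner_product_space L"
    and form: "simultaneous_sum_form H T K L"
  shows "EP_operator H T"
proof -
  interpret complex_hilbert_space H by (rule H)
  interpret T: bounded_operator_on_hilbert_space H H T
    by unfold_locales (rule T)
  interpret K: complex_inner_product_space K by (rule K)
  interpret L: complex_inner_product_space L by (rule L)
  let ?S = "K \<oplus>\<^sub>H L"
  obtain U A B where U: "U \<in> isomorphisms ?S H" and A: "A \<in> isomorphisms K K"
    and B: "B \<in> bounded_operators K K"
    and T_eq: "\<forall>x\<in>carrier H. T x = U (map_prod A (\<lambda>_. \<zero>\<^bsub>L\<^esub>) (inv_into (carrier ?S) U x))"
    and Tstar_eq:
      "\<forall>x\<in>carrier H. T.Tstar x = U (map_prod B (\<lambda>_. \<zero>\<^bsub>L\<^esub>) (inv_into (carrier ?S) U x))"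
    using form unfolding simultaneous_sum_form_def by blast
  have Ub: "U \<in> bounded_operators ?S H" and U_bij: "bij_betw U (carrier ?S) (carrier H)"
    using U by (simp_all add: isomorphisms_def)
  have Ab: "A \<in> bounded_operators K K" and A_bij: "bij_betw A (carrier K) (carrier K)"
    using A by (simp_all add: isomorphisms_def)
  interpret A: bounded_operator K K A by unfold_locales (rule Ab)
  interpret B: bounded_operator K K B by unfold_locales (rule B)
  have U_in: "U (y, z) \<in> carrier H" if "y \<in> carrier K" "z \<in> carrier L" for y z
    using bounded_operators_closed[OF Ub, of "(y, z)"] that by simp
  have U_inj: "U p = U p' \<longleftrightarrow> p = p'" if "p \<in> carrier ?S" "p' \<in> carrier ?S" for p p'
    using U_bij that by (meson bij_betw_def inj_on_eq_iff)
  have U_inv: "inv_into (carrier ?S) U (U (y, z)) = (y, z)"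
    if "y \<in> carrier K" "z \<in> carrier L" for y z
    using U_bij that by (intro inv_into_f_f) (auto simp: bij_betw_def)
  have TU: "T (U (y, z)) = U (A y, \<zero>\<^bsub>L\<^esub>)" if "y \<in> carrier K" "z \<in> carrier L" for y z
    using T_eq U_in[OF that] U_inv[OF that] by simp
  have TstarU: "T.Tstar (U (y, z)) = U (B y, \<zero>\<^bsub>L\<^esub>)" if "y \<in> carrier K" "z \<in> carrier L" for y z
    using Tstar_eq U_in[OF that] U_inv[OF that] by simp
  have U_zero: "U (\<zero>\<^bsub>K\<^esub>, \<zero>\<^bsub>L\<^esub>) = \<zero>\<^bsub>H\<^esub>"
    using bounded_operators_smult[OF Ub, of "(\<zero>\<^bsub>K\<^esub>, \<zero>\<^bsub>L\<^esub>)" 0]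
      K.smult_l_null[of "\<zero>\<^bsub>K\<^esub>"] L.smult_l_null[of "\<zero>\<^bsub>L\<^esub>"]
      smult_l_null[OF U_in, of "\<zero>\<^bsub>K\<^esub>" "\<zero>\<^bsub>L\<^esub>"] by simp
  have U_surj: "\<exists>y z. y \<in> carrier K \<and> z \<in> carrier L \<and> x = U (y, z)" if "x \<in> carrier H" for x
  proof -
    have "x \<in> U ` (carrier K \<times> carrier L)" using that U_bij by (simp add: bij_betw_def)
    then show ?thesis by auto
  qed
  have sub: "a_kernel H H T \<subseteq> a_kernel H H T.Tstar"
  proof
    fix x assume "x \<in> a_kernel H H T"
    then have x: "x \<in> carrier H" "T x = \<zero>\<^bsub>H\<^esub>" by (auto simp: a_kernel_def')
    obtain y z where yz: "y \<in> carrier K" "z \<in> carrier L" "x = U (y, z)"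
      using U_surj[OF x(1)] by blast
    have "U (A y, \<zero>\<^bsub>L\<^esub>) = U (\<zero>\<^bsub>K\<^esub>, \<zero>\<^bsub>L\<^esub>)"
      using x yz TU U_zero by simp
    then have "A y = A \<zero>\<^bsub>K\<^esub>" using U_inj[of "(A y, \<zero>\<^bsub>L\<^esub>)" "(\<zero>\<^bsub>K\<^esub>, \<zero>\<^bsub>L\<^esub>)"] yz by simp
    then have "y = \<zero>\<^bsub>K\<^esub>" using A_bij yz by (meson bij_betw_def inj_on_eq_iff K.M.zero_closed)
    then have "T.Tstar x = \<zero>\<^bsub>H\<^esub>" using yz TstarU U_zero by simp
    then show "x \<in> a_kernel H H T.Tstar" using x by (simp add: a_kernel_def')
  qed
  have "x \<in> a_kernel H H T" if x: "x \<in> a_kernel H H T.Tstar" for x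
  proof -
    have xH: "x \<in> carrier H" and orth: "\<And>v. v \<in> carrier H \<Longrightarrow> cinner H (T v) x = 0"
      using x by (auto simp: T.cadjoint_kernel)
    obtain y z where yz: "y \<in> carrier K" "z \<in> carrier L" "x = U (y, z)"
      using U_surj[OF xH] by blast
    \<comment> \<open>\<open>U (y, 0)\<close> lies in the range of \<open>T\<close> because \<open>A\<close> is onto\<close>
    obtain k where k: "k \<in> carrier K" "A k = y"
      using A_bij yz(1) by (metis bij_betw_def imageE)
    define u where "u = U (k, \<zero>\<^bsub>L\<^esub>)"
    define n where "n = U (\<zero>\<^bsub>K\<^esub>, z)"
    have u: "u \<in> carrier H" and n: "n \<in> carrier H"
      using k yz U_in by (simp_all add: u_def n_def)
    have "T u = U (y, \<zero>\<^bsub>L\<^esub>)" using k TU by (simp add: u_def)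
    then have x_eq: "x = T u \<oplus>\<^bsub>H\<^esub> n"
      using bounded_operators_add[OF Ub, of "(y, \<zero>\<^bsub>L\<^esub>)" "(\<zero>\<^bsub>K\<^esub>, z)"] yz by (simp add: n_def)
    have "T n = \<zero>\<^bsub>H\<^esub>" using TU yz U_zero by (simp add: n_def)
    then have n_ker: "n \<in> a_kernel H H T" using n by (simp add: a_kernel_def')
    then have "cinner H (T u) n = 0" using sub u by (auto simp: T.cadjoint_kernel)
    then have "cinner H (T u) (T u) = 0"
      using orth[OF u] u n by (simp add: x_eq cinner_add_right)
    then have "T u = \<zero>\<^bsub>H\<^esub>" using u by (intro cinner_self_eq_zero) simp_all
    then show ?thesis using n_ker n by (simp add: x_eq)
  qed
  then have "a_kernel H H T = a_kernel H H T.Tstar" using sub by blast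
  then show ?thesis using T cl by (simp add: EP_operator_def)
qed

text \<open>
  For an EP operator, \<open>H\<close> is the orthogonal sum of the range and the kernel of \<open>T\<close>. Both \<open>T\<close> and its
  adjoint vanish on the kernel and map the range into itself, and \<open>U\<close> is addition.
\<close>

lemma EP_operator_imp_simultaneous_sum_form:
  assumes H: "complex_hilbert_space H" and EP: "EP_operator H T"
  defines "K \<equiv> H\<lparr>carrier := T ` carrier H\<rparr>"
    and "L \<equiv> H\<lparr>carrier := a_kernel H H T\<rparr>"
  shows "complex_hilbert_space K" "complex_hilbert_space L" "simultaneous_sum_form H T K L"
proof -
  interpret complex_hilbert_space H by (rule H)
  have T: "T \<in> bounded_operators H H" and cl: "closed_range H H T"
    and ker: "a_kernel H H T = a_kernel H H (cadjoint H H T)"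
    using EP by (simp_all add: EP_operator_def)
  interpret T: bounded_operator_on_hilbert_space H H T
    by unfold_locales (rule T)
  define R where "R = T ` carrier H"
  define N where "N = a_kernel H H T"
  have R_sub: "submodule R complex_ring H" and N_sub: "submodule N complex_ring H"
    using T.range_submodule T.kernel_submodule by (simp_all add: R_def N_def)
  have R_closed: "closedin (ctopology H) R" using cl by (simp add: closed_range_def R_def)
  show K: "complex_hilbert_space K"
    using closed_submodule_hilbert_space[OF R_sub R_closed] by (simp add: K_def R_def)
  show L: "complex_hilbert_space L"
    using closed_submodule_hilbert_space[OF N_sub] T.kernel_closed by (simp add: L_def N_def)
  have K_simps [simp]: "carrier K = R" "add K = add H" "smult K = smult H" "cinner K = cinner H"
      "cnorm K = cnorm H" "zero K = zero H"
    and L_simps [simp]: "carrier L = N" "add L = add H" "smult L = smult H" "cinner L = cinner H"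
      "cnorm L = cnorm H" "zero L = zero H"
    by (simp_all add: K_def L_def R_def N_def cnorm_def fun_eq_iff)
  have RH: "y \<in> carrier H" if "y \<in> R" for y using that by (auto simp: R_def)
  have NH: "z \<in> carrier H" and TN: "T z = \<zero>\<^bsub>H\<^esub>" and TstarN: "T.Tstar z = \<zero>\<^bsub>H\<^esub>" if "z \<in> N" for z
    using that ker by (auto simp: N_def a_kernel_def')
  have N_orth: "N = {z \<in> carrier H. \<forall>y\<in>R. cinner H y z = 0}"
    unfolding N_def ker T.cadjoint_kernel by (auto simp: R_def)
  have orth: "cinner H y z = 0" if "y \<in> R" "z \<in> N" for y z using that by (simp add: N_orth)
  have zero_R: "\<zero>\<^bsub>H\<^esub> \<in> R" and zero_N: "\<zero>\<^bsub>H\<^esub> \<in> N"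
    using T.zero by (auto simp: R_def N_def a_kernel_def' intro: rev_image_eqI)
  have R_minus: "y \<ominus>\<^bsub>H\<^esub> y' \<in> R" if "y \<in> R" "y' \<in> R" for y y'
    using that submoduleE(3,5)[OF R_sub] by (simp add: a_minus_def)
  have decomp: "\<exists>y z. y \<in> R \<and> z \<in> N \<and> x = y \<oplus>\<^bsub>H\<^esub> z" if "x \<in> carrier H" for x
  proof (rule orthogonal_decomposition[OF R_sub R_closed that])
    fix y z assume *: "y \<in> R" "z \<in> carrier H" "\<And>m. m \<in> R \<Longrightarrow> cinner H m z = 0" "x = y \<oplus>\<^bsub>H\<^esub> z"
    then have "z \<in> N" by (simp add: N_orth)
    with * show ?thesis by blast
  qed
  have R_eqI: "y = y'"
    if "y \<in> R" "y' \<in> R" "\<And>w. w \<in> R \<Longrightarrow> cinner H w y = cinner H w y'" for y y'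
  proof (rule eq_if_minus_zero)
    show "y \<ominus>\<^bsub>H\<^esub> y' = \<zero>\<^bsub>H\<^esub>"
      using that(3)[OF R_minus[OF that(1,2)]] RH[OF that(1)] RH[OF that(2)]
      by (intro cinner_self_eq_zero) (simp_all add: cinner_minus_right)
  qed (use that RH in auto)

  define U where "U = (\<lambda>(y, z). y \<oplus>\<^bsub>H\<^esub> z)"
  have inj: "inj_on U (R \<times> N)"
  proof (rule inj_onI, clarify)
    fix y z y' z' assume y: "y \<in> R" "y' \<in> R" and z: "z \<in> N" "z' \<in> N" and "U (y, z) = U (y', z')"
    then have eq: "y \<oplus>\<^bsub>H\<^esub> z = y' \<oplus>\<^bsub>H\<^esub> z'" by (simp add: U_def)
    have "cinner H w y = cinner H w y'" if w: "w \<in> R" for w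
      using arg_cong[OF eq, of "cinner H w"] orth[OF w] y z w
      by (simp add: cinner_add_right RH NH)
    then have "y = y'" using y by (intro R_eqI)
    moreover from this have "z = z'" using eq y z by (simp add: RH NH)
    ultimately show "y = y' \<and> z = z'" by simp
  qed
  have "cnorm H (U p) \<le> 2 * cnorm (K \<oplus>\<^sub>H L) p" if p_in: "p \<in> R \<times> N" for p
  proof -
    obtain y z where p: "p = (y, z)" "y \<in> R" "z \<in> N" using p_in by auto
    have yz: "y \<in> carrier H" "z \<in> carrier H" using p RH NH by auto
    have "cnorm H y \<le> cnorm (K \<oplus>\<^sub>H L) p" "cnorm H z \<le> cnorm (K \<oplus>\<^sub>H L) p"
      using yz by (simp_all add: p cnorm_def cinner_nonneg)
    moreover have "cnorm H (U p) \<le> cnorm H y + cnorm H z"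
      using cnorm_triangle[OF yz] by (simp add: p U_def)
    ultimately show ?thesis by linarith
  qed
  then have U_bounded: "U \<in> bounded_operators (K \<oplus>\<^sub>H L) H"
    unfolding bounded_operators_def
    by (auto simp: U_def RH NH smult_r_distr M.a_ac)
  have "U ` (R \<times> N) = carrier H"
  proof
    show "U ` (R \<times> N) \<subseteq> carrier H" by (auto simp: U_def RH NH)
    show "carrier H \<subseteq> U ` (R \<times> N)" using decomp by (force simp: U_def)
  qed
  then have U_iso: "U \<in> isomorphisms (K \<oplus>\<^sub>H L) H"
    using U_bounded inj by (simp add: isomorphisms_def bij_betw_def)
  have U_inv: "inv_into (R \<times> N) U (y \<oplus>\<^bsub>H\<^esub> z) = (y, z)" if "y \<in> R" "z \<in> N" for y z
    using inv_into_f_f[OF inj, of "(y, z)"] that by (simp add: U_def)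

  have restrict: "F \<in> bounded_operators K K"
    if F: "F \<in> bounded_operators H H" and FR: "\<And>y. y \<in> R \<Longrightarrow> F y \<in> R" for F
  proof -
    obtain C where "\<And>x. x \<in> carrier H \<Longrightarrow> cnorm H (F x) \<le> C * cnorm H x"
      using bounded_operators_bound[OF complex_inner_product_space_axioms F] by blast
    then have "\<exists>C. \<forall>y\<in>R. cnorm H (F y) \<le> C * cnorm H y" using RH by blast
    then show ?thesis
      unfolding bounded_operators_def
      by (simp add: FR RH bounded_operators_add[OF F] bounded_operators_smult[OF F])
  qed
  have T_bounded: "T \<in> bounded_operators K K"
    using RH by (intro restrict T) (simp add: R_def)
  have "inj_on T R"
  proof (rule inj_onI)
    fix y y' assume y: "y \<in> R" "y' \<in> R" and eq: "T y = T y'"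
    have "y \<ominus>\<^bsub>H\<^esub> y' \<in> N"
      using y eq by (simp add: N_def a_kernel_def' RH T.minus) (simp add: a_minus_def RH M.r_neg)
    then have "y \<ominus>\<^bsub>H\<^esub> y' = \<zero>\<^bsub>H\<^esub>"
      using orth R_minus[OF y] RH by (intro cinner_self_eq_zero) auto
    then show "y = y'" using y RH eq_if_minus_zero by blast
  qed
  moreover have "T ` R = R"
  proof
    show "T ` R \<subseteq> R" using RH by (auto simp: R_def)
    show "R \<subseteq> T ` R"
    proof
      fix r assume "r \<in> R"
      then obtain x where x: "x \<in> carrier H" "r = T x" by (auto simp: R_def)
      obtain y z where yz: "y \<in> R" "z \<in> N" "x = y \<oplus>\<^bsub>H\<^esub> z" using decomp[OF x(1)] by blast
      then have "r = T y" by (simp add: x T.add TN RH NH)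
      then show "r \<in> T ` R" using yz by blast
    qed
  qed
  ultimately have T_iso: "T \<in> isomorphisms K K"
    using T_bounded by (simp add: isomorphisms_def bij_betw_def)

  \<comment> \<open>the range of the adjoint is orthogonal to the kernel of \<open>T\<close>\<close>
  have Tstar_R: "T.Tstar x \<in> R" if x: "x \<in> carrier H" for x
  proof -
    obtain y z where yz: "y \<in> R" "z \<in> N" "T.Tstar x = y \<oplus>\<^bsub>H\<^esub> z"
      using decomp[OF T.cadjoint_closed[OF x]] by blast
    have "cinner H z (y \<oplus>\<^bsub>H\<^esub> z) = 0"
      using T.cinner_cadjoint[OF x NH[OF yz(2)]] by (simp add: yz(3) TN[OF yz(2)] cinner_zero x)
    moreover have "cinner H z y = 0"
      using cinner_commute[of z y] orth[OF yz(1,2)] by (simp add: RH NH yz)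
    ultimately have "z = \<zero>\<^bsub>H\<^esub>"
      using yz by (intro cinner_self_eq_zero) (simp_all add: cinner_add_right RH NH)
    then show ?thesis using yz by (simp add: RH)
  qed
  have Tstar_H: "T.Tstar \<in> bounded_operators H H" by (rule T.cadjoint_bounded)
  have Tstar_bounded: "T.Tstar \<in> bounded_operators K K"
    using Tstar_R RH by (intro restrict Tstar_H) simp
  have form: "F x = U (map_prod F (\<lambda>_. \<zero>\<^bsub>L\<^esub>) (inv_into (carrier (K \<oplus>\<^sub>H L)) U x))"
    if F: "F \<in> bounded_operators H H" "\<And>z. z \<in> N \<Longrightarrow> F z = \<zero>\<^bsub>H\<^esub>" and x: "x \<in> carrier H" for F x
  proof -
    obtain y z where yz: "y \<in> R" "z \<in> N" "x = y \<oplus>\<^bsub>H\<^esub> z" using decomp[OF x] by blast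
    have "F x = F y \<oplus>\<^bsub>H\<^esub> \<zero>\<^bsub>H\<^esub>"
      using bounded_operators_add[OF F(1)] F(2) yz by (simp add: RH NH)
    then show ?thesis using yz U_inv by (simp add: U_def)
  qed
  show "simultaneous_sum_form H T K L"
    unfolding simultaneous_sum_form_def
    using U_iso T_iso Tstar_bounded form[OF T TN] form[OF Tstar_H TstarN] by blast
qed

theorem proposition3p8:
  fixes H :: "'h cinner_space" and T :: "'h \<Rightarrow> 'h"
  assumes "complex_hilbert_space H"
    and "T \<in> bounded_operators H H"
    and "closed_range H H T"
  shows "(EP_operator H T \<longleftrightarrow>
           (\<exists>(K1 :: 'h cinner_space) (L1 :: 'h cinner_space).
              complex_hilbert_space K1 \<and> complex_hilbert_space L1
              \<and> simultaneous_sum_form H T K1 L1))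
       \<and> ((\<exists>(K1 :: 'k cinner_space) (L1 :: 'l cinner_space).
              complex_hilbert_space K1 \<and> complex_hilbert_space L1
              \<and> simultaneous_sum_form H T K1 L1)
           \<longrightarrow> EP_operator H T)"
proof (intro conjI iffI impI)
  assume "EP_operator H T"
  from EP_operator_imp_simultaneous_sum_form[OF assms(1) this]
  show "\<exists>(K1 :: 'h cinner_space) (L1 :: 'h cinner_space).
      complex_hilbert_space K1 \<and> complex_hilbert_space L1 \<and> simultaneous_sum_form H T K1 L1"
    by (intro exI conjI)
next
  assume "\<exists>(K1 :: 'h cinner_space) (L1 :: 'h cinner_space).
      complex_hilbert_space K1 \<and> complex_hilbert_space L1 \<and> simultaneous_sum_form H T K1 L1"
  then show "EP_operator H T"
    by (elim exE conjE)
      (rule simultaneous_sum_form_imp_EP_operator[OF assms]; (rule complex_hilbert_space.axioms)?)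
next
  assume "\<exists>(K1 :: 'k cinner_space) (L1 :: 'l cinner_space).
      complex_hilbert_space K1 \<and> complex_hilbert_space L1 \<and> simultaneous_sum_form H T K1 L1"
  then show "EP_operator H T"
    by (elim exE conjE)
      (rule simultaneous_sum_form_imp_EP_operator[OF assms]; (rule complex_hilbert_space.axioms)?)
qed

end
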